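(* Any proof labeling scheme for $\textsc{Permutation-Recognition}$, and any proof labeling scheme for $\textsc{Trapezoid-Recognition}$, must use certificates of size $\Omega(\log n)$ bits on $n$-node networks.
   Context: A permutation graph is a graph $G=([n],E)$, $[n]=\{0,\dots,n-1\}$ (up to isomorphism), for which there is a permutation $\pi$ of $[n]$ with $\{i,j\}\in E$ iff $(i-j)(\pi(i)-\pi(j))<0$. A trapezoid graph is the intersection graph of trapezoids each having one side on a fixed top horizontal line and one side on a fixed parallel bottom line. $\textsc{Permutation-Recognition}$ (resp. $\textsc{Trapezoid-Recognition}$) is the set of configurations $\langle G,\mathrm{id}\rangle$ with $G$ a permutation (resp. trapezoid) graph. Distributed setting: $G$ is a simple connected $n$-node graph, nodes have unique identifiers in $\{1,\dots,\mathrm{poly}(n)\}$. A proof labeling scheme: an untrusted prover assigns each node a certificate; in one deterministic round each node sees its own id and certificate and those of its neighbors, and accepts or rejects; on yes-instances some assignment makes all nodes accept, on no-instances every assignment makes some node reject. Its size is the maximum certificate length. *)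

theory Defs
  imports "HOL-Analysis.Analysis" "HOL-Library.Landau_Symbols"
begin

definition simple_graph :: "nat \<Rightarrow> (nat \<Rightarrow> nat \<Rightarrow> bool) \<Rightarrow> bool" where
  "simple_graph n E \<longleftrightarrow>
     (\<forall>u v. E u v \<longrightarrow> u < n \<and> v < n) \<and> (\<forall>u v. E u v \<longrightarrow> E v u) \<and> (\<forall>u. \<not> E u u)"

definition connected_graph :: "nat \<Rightarrow> (nat \<Rightarrow> nat \<Rightarrow> bool) \<Rightarrow> bool" where
  "connected_graph n E \<longleftrightarrow> (\<forall>u<n. \<forall>v<n. E\<^sup>*\<^sup>* u v)"

definition permutation_graph :: "nat \<Rightarrow> (nat \<Rightarrow> nat \<Rightarrow> bool) \<Rightarrow> bool" where
  "permutation_graph n E \<longleftrightarrow>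
     (\<exists>f pi. bij_betw f {0..<n} {0..<n} \<and> pi permutes {0..<n} \<and>
        (\<forall>u<n. \<forall>v<n. E u v \<longleftrightarrow>
            (int (f u) - int (f v)) * (int (pi (f u)) - int (pi (f v))) < 0))"

definition trapezoid :: "real \<Rightarrow> real \<Rightarrow> real \<Rightarrow> real \<Rightarrow> (real \<times> real) set" where
  "trapezoid a b c d = convex hull {(a, 1), (b, 1), (c, 0), (d, 0)}"

definition trapezoid_graph :: "nat \<Rightarrow> (nat \<Rightarrow> nat \<Rightarrow> bool) \<Rightarrow> bool" where
  "trapezoid_graph n E \<longleftrightarrow>
     (\<exists>a b c d :: nat \<Rightarrow> real.
        (\<forall>u<n. a u \<le> b u \<and> c u \<le> d u) \<and>
        (\<forall>u<n. \<forall>v<n. E u v \<longleftrightarrow>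
            u \<noteq> v \<and> trapezoid (a u) (b u) (c u) (d u) \<inter> trapezoid (a v) (b v) (c v) (d v) \<noteq> {}))"

definition legal_config :: "nat \<Rightarrow> nat \<Rightarrow> (nat \<Rightarrow> nat \<Rightarrow> bool) \<Rightarrow> (nat \<Rightarrow> nat) \<Rightarrow> bool" where
  "legal_config k n E ident \<longleftrightarrow>
     n \<ge> 1 \<and> simple_graph n E \<and> connected_graph n E \<and>
     inj_on ident {0..<n} \<and> (\<forall>u<n. ident u \<in> {1..n ^ k})"

definition local_view ::
  "nat \<Rightarrow> (nat \<Rightarrow> nat \<Rightarrow> bool) \<Rightarrow> (nat \<Rightarrow> nat) \<Rightarrow> (nat \<Rightarrow> bool list) \<Rightarrow> nat
     \<Rightarrow> nat \<times> bool list \<times> (nat \<times> bool list) set" where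
  "local_view n E ident cert u = (ident u, cert u, {(ident v, cert v) | v. v < n \<and> E u v})"

definition is_pls ::
  "(nat \<Rightarrow> (nat \<Rightarrow> nat \<Rightarrow> bool) \<Rightarrow> bool) \<Rightarrow> nat
    \<Rightarrow> (nat \<times> bool list \<times> (nat \<times> bool list) set \<Rightarrow> bool) \<Rightarrow> (nat \<Rightarrow> nat) \<Rightarrow> bool" where
  "is_pls P k Ver s \<longleftrightarrow>
     (\<forall>n E ident. legal_config k n E ident \<and> P n E \<longrightarrow>
        (\<exists>cert. (\<forall>u<n. length (cert u) \<le> s n) \<and>
               (\<forall>u<n. Ver (local_view n E ident cert u)))) \<and>
     (\<forall>n E ident cert. legal_config k n E ident \<and> \<not> P n E \<longrightarrow>
        (\<exists>u<n. \<not> Ver (local_view n E ident cert u)))"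

end

theory Submission
  imports Defs "HOL-Combinatorics.Permutations"
begin

text \<open>Fix identifiers and consider, for permutations \<open>\<sigma>\<close>, \<open>\<tau>\<close> of \<open>{0..<m}\<close>, the graph with
  edges \<open>a'\<^sub>i a\<^sub>i\<close>, \<open>a\<^sub>i b\<^bsub>\<sigma> i\<^esub>\<close>, \<open>b\<^sub>j b'\<^sub>j\<close>, \<open>a'\<^sub>i b'\<^bsub>\<tau> i\<^esub>\<close> together with a
  universal vertex. If \<open>\<sigma> = \<tau>\<close>, this is the cone over disjoint four-cycles, a permutation
  graph; otherwise it contains a chordless cycle of length at least eight and is not a trapezoid
  graph. Only \<open>a\<^sub>i\<close>, \<open>b\<^sub>j\<close> see \<open>\<sigma>\<close> and only \<open>a'\<^sub>i\<close>, \<open>b'\<^sub>j\<close> see \<open>\<tau>\<close>. So if the instances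
  \<open>(\<sigma>, \<sigma>)\<close> and \<open>(\<tau>, \<tau>)\<close> are accepted with the same certificates, the mixed instance \<open>(\<sigma>, \<tau>)\<close>
  is accepted as well. Hence the \<open>m!\<close> permutations need distinct certificate assignments, of
  which there are only \<open>2\<close> to the \<open>O(n s)\<close>, where \<open>n\<close> is about \<open>4 m\<close>.\<close>

section \<open>Trapezoids\<close>

text \<open>A line that passes through the gap between the two trapezoids on top and on bottom
  separates their corners, hence their convex hulls.\<close>

lemma trapezoid_disjoint_if_left:
  assumes "a \<le> b" "c \<le> d" "a' \<le> b'" "c' \<le> d'" "b < a'" "d < c'"
  shows "trapezoid a b c d \<inter> trapezoid a' b' c' d' = {}"
proof -
  define \<beta> where "\<beta> = (b + a') / 2"
  define \<gamma> where "\<gamma> = (d + c') / 2"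
  have bounds: "b < \<beta>" "\<beta> < a'" "d < \<gamma>" "\<gamma> < c'"
    using assms by (auto simp: \<beta>_def \<gamma>_def)
  \<comment> \<open>The points with \<open>inner (1, \<gamma> - \<beta>) x = \<gamma>\<close> form
    the line through \<open>(\<beta>, 1)\<close> and \<open>(\<gamma>, 0)\<close>.\<close>
  have "trapezoid a b c d \<subseteq> {x. inner (1, \<gamma> - \<beta>) x < \<gamma>}"
    unfolding trapezoid_def using assms bounds
    by (intro hull_minimal convex_halfspace_lt) (auto simp: inner_prod_def)
  moreover have "trapezoid a' b' c' d' \<subseteq> {x. inner (1, \<gamma> - \<beta>) x > \<gamma>}"
    unfolding trapezoid_def using assms bounds
    by (intro hull_minimal convex_halfspace_gt) (auto simp: inner_prod_def)
  ultimately show ?thesis by fastforce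
qed

lemma segment_in_trapezoid:
  assumes "a \<le> p" "p \<le> b" "c \<le> q" "q \<le> d" "0 \<le> t" "t \<le> 1"
  shows "(t * p + (1 - t) * q, t) \<in> trapezoid a b c d"
proof -
  let ?T = "trapezoid a b c d"
  have conv: "convex ?T" by (simp add: trapezoid_def)
  have verts: "(a, 1) \<in> ?T" "(b, 1) \<in> ?T" "(c, 0) \<in> ?T" "(d, 0) \<in> ?T"
    unfolding trapezoid_def by (auto intro: hull_inc)
  have edge: "(p, h) \<in> ?T" if "(x, h) \<in> ?T" "(y, h) \<in> ?T" "x \<le> p" "p \<le> y" for x y p h :: real
  proof -
    have "p \<in> closed_segment x y"
      using that by (simp add: closed_segment_eq_real_ivl)
    then obtain u where u: "0 \<le> u" "u \<le> 1" "p = (1 - u) * x + u * y"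
      by (auto simp: in_segment)
    have "(1 - u) *\<^sub>R (x, h) + u *\<^sub>R (y, h) \<in> ?T"
      using conv that u by (intro convexD_alt) auto
    moreover have "(1 - u) *\<^sub>R (x, h) + u *\<^sub>R (y, h) = (p, h)"
      using u by (simp add: algebra_simps)
    ultimately show ?thesis by simp
  qed
  have "(p, 1) \<in> ?T" "(q, 0) \<in> ?T"
    using edge[OF verts(1,2)] edge[OF verts(3,4)] assms by blast+
  then have "(1 - t) *\<^sub>R (q, 0) + t *\<^sub>R (p, 1) \<in> ?T"
    using conv assms by (intro convexD_alt) auto
  then show ?thesis by (simp add: algebra_simps)
qed

text \<open>The segment from \<open>(b, 1)\<close> to \<open>(c, 0)\<close> in the first trapezoid
  and the one from \<open>(a', 1)\<close> to \<open>(d', 0)\<close> in the second have their ends in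
  opposite orders, so they cross.\<close>

lemma trapezoid_meet_if_cross:
  assumes "a \<le> b" "c \<le> d" "a' \<le> b'" "c' \<le> d'" "a' \<le> b" "c \<le> d'"
  shows "trapezoid a b c d \<inter> trapezoid a' b' c' d' \<noteq> {}"
proof -
  define D where "D = (b - a') + (d' - c)"
  \<comment> \<open>The height of the crossing. If \<open>D = 0\<close>, the two segments coincide,
    and division by zero yields the valid choice \<open>t = 0\<close>.\<close>
  define t where "t = (d' - c) / D"
  have t: "0 \<le> t" "t \<le> 1"
    using assms by (auto simp: t_def D_def divide_le_eq_1)
  have "t * D = d' - c"
    using assms by (cases "D = 0") (auto simp: t_def D_def)
  then have "t * b + (1 - t) * c = t * a' + (1 - t) * d'"
    by (simp add: D_def algebra_simps)
  moreover have "(t * b + (1 - t) * c, t) \<in> trapezoid a b c d"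
    using assms t by (intro segment_in_trapezoid) auto
  moreover have "(t * a' + (1 - t) * d', t) \<in> trapezoid a' b' c' d'"
    using assms t by (intro segment_in_trapezoid) auto
  ultimately show ?thesis by auto
qed

lemma trapezoid_meet_iff:
  assumes "a \<le> b" "c \<le> d" "a' \<le> b'" "c' \<le> d'"
  shows "trapezoid a b c d \<inter> trapezoid a' b' c' d' \<noteq> {} \<longleftrightarrow>
         \<not> (b < a' \<and> d < c') \<and> \<not> (b' < a \<and> d' < c)" (is "?meet \<longleftrightarrow> ?cross")
proof
  assume ?meet
  then show ?cross
    using trapezoid_disjoint_if_left[of a b c d a' b' c' d']
      trapezoid_disjoint_if_left[of a' b' c' d' a b c d] assms by blast
next
  assume ?cross
  \<comment> \<open>Distributing the two negated conjunctions leaves four cases: the top sides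
    overlap, the bottom sides overlap, or two diagonals cross in one of two ways.\<close>
  then consider "a' \<le> b" "a \<le> b'" | "c' \<le> d" "c \<le> d'" | "a' \<le> b" "c \<le> d'" | "a \<le> b'" "c' \<le> d"
    by linarith
  then show ?meet
  proof cases
    case 1
    have "(max a a', 1) \<in> trapezoid a b c d"
      using segment_in_trapezoid[of a "max a a'" b c c d 1] 1 assms by simp
    moreover have "(max a a', 1) \<in> trapezoid a' b' c' d'"
      using segment_in_trapezoid[of a' "max a a'" b' c' c' d' 1] 1 assms by simp
    ultimately show ?thesis by blast
  next
    case 2
    have "(max c c', 0) \<in> trapezoid a b c d"
      using segment_in_trapezoid[of a a b c "max c c'" d 0] 2 assms by simp
    moreover have "(max c c', 0) \<in> trapezoid a' b' c' d'"
      using segment_in_trapezoid[of a' a' b' c' "max c c'" d' 0] 2 assms by simp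
    ultimately show ?thesis by blast
  next
    case 3
    then show ?thesis using trapezoid_meet_if_cross assms by blast
  next
    case 4
    then show ?thesis
      using trapezoid_meet_if_cross[of a' b' c' d' a b c d] assms by blast
  qed
qed

section \<open>Permutation graphs, trapezoid graphs and cocomparability graphs\<close>

text \<open>Vertex \<open>u\<close> becomes the degenerate trapezoid from \<open>(f u, 1)\<close> to
  \<open>(pi (f u), 0)\<close>; two such segments with distinct ends meet exactly at an
  inversion.\<close>

lemma permutation_graph_imp_trapezoid_graph:
  assumes "permutation_graph n E"
  shows "trapezoid_graph n E"
proof -
  obtain f pi where f: "bij_betw f {0..<n} {0..<n}" and pi: "pi permutes {0..<n}"
    and E: "\<And>u v. u < n \<Longrightarrow> v < n \<Longrightarrow> E u v \<longleftrightarrow>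
      (int (f u) - int (f v)) * (int (pi (f u)) - int (pi (f v))) < 0"
    using assms unfolding permutation_graph_def by blast
  define x where "x u = real (f u)" for u
  define y where "y u = real (pi (f u))" for u
  have "E u v \<longleftrightarrow> u \<noteq> v \<and>
      trapezoid (x u) (x u) (y u) (y u) \<inter> trapezoid (x v) (x v) (y v) (y v) \<noteq> {}"
    if "u < n" "v < n" for u v
  proof -
    have "f u \<noteq> f v \<and> pi (f u) \<noteq> pi (f v)" if "u \<noteq> v"
      using f inj_onD[OF bij_betw_imp_inj_on[OF f]] permutes_inj[OF pi] \<open>u < n\<close> \<open>v < n\<close> that
      by (metis atLeastLessThan_iff injD zero_le)
    then show ?thesis
      using E[OF that]
      by (subst trapezoid_meet_iff) (auto simp: x_def y_def mult_less_0_iff)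
  qed
  then show ?thesis
    unfolding trapezoid_graph_def by (intro exI[of _ x] exI[of _ y]) auto
qed

text \<open>Trapezoid graphs are cocomparability graphs: \<open>L\<close> is ``lies entirely to the left of''.\<close>

lemma trapezoid_graph_cocomparability:
  assumes "trapezoid_graph n E"
  shows "\<exists>L. irreflp L \<and> transp L \<and>
    (\<forall>u<n. \<forall>v<n. u \<noteq> v \<longrightarrow> (E u v \<longleftrightarrow> \<not> L u v \<and> \<not> L v u))"
proof -
  obtain a b c d :: "nat \<Rightarrow> real"
    where le: "\<forall>u<n. a u \<le> b u \<and> c u \<le> d u"
    and E: "\<forall>u<n. \<forall>v<n. E u v \<longleftrightarrow> u \<noteq> v \<and>
      trapezoid (a u) (b u) (c u) (d u) \<inter> trapezoid (a v) (b v) (c v) (d v) \<noteq> {}"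
    using assms unfolding trapezoid_graph_def by (elim exE conjE)
  \<comment> \<open>The bounds \<open>u < n\<close> and \<open>v < n\<close> make \<open>L\<close>
    irreflexive and transitive on all naturals, since \<open>le\<close> speaks only of vertices
    below \<open>n\<close>.\<close>
  define L where "L u v \<longleftrightarrow> u < n \<and> v < n \<and> b u < a v \<and> d u < c v" for u v
  have "\<not> L u u" for u
    using le[rule_format, of u] by (auto simp: L_def)
  moreover have "L u w" if "L u v" "L v w" for u v w
    using that le[rule_format, of v] by (auto simp: L_def)
  moreover have "E u v \<longleftrightarrow> \<not> L u v \<and> \<not> L v u" if "u < n" "v < n" "u \<noteq> v" for u v
    using that le[rule_format, of u] le[rule_format, of v] E[rule_format, of u v] by (simp add: trapezoid_meet_iff L_def)
  ultimately show ?thesis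
    by (intro exI[of _ L] conjI irreflpI transpI allI impI) blast+
qed

section \<open>Permutation graphs from two linear orders\<close>

text \<open>\<open>r u\<close> is the rank of \<open>u\<close> under the key \<open>x\<close>;
  distinct keys have distinct ranks.\<close>

lemma card_less_bij_betw:
  fixes x :: "nat \<Rightarrow> int"
  assumes "inj_on x {0..<n}"
  defines "r \<equiv> (\<lambda>u. card {w \<in> {0..<n}. x w < x u})"
  shows "bij_betw r {0..<n} {0..<n}"
    and "\<And>u v. u < n \<Longrightarrow> v < n \<Longrightarrow> r u < r v \<longleftrightarrow> x u < x v"
proof -
  have mono: "r u < r v" if "u < n" "x u < x v" for u v
    unfolding r_def using that by (intro psubset_card_mono) auto
  show less: "r u < r v \<longleftrightarrow> x u < x v" if "u < n" "v < n" for u v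
    using mono[of u v] mono[of v u] that inj_onD[OF assms(1), of u v]
    by (cases "x u" "x v" rule: linorder_cases) auto
  have "inj_on r {0..<n}"
  proof (rule inj_onI)
    fix u v assume uv: "u \<in> {0..<n}" "v \<in> {0..<n}" "r u = r v"
    then have "x u = x v" using less[of u v] less[of v u] by simp
    then show "u = v" using inj_onD[OF assms(1)] uv by blast
  qed
  moreover have "r ` {0..<n} \<subseteq> {0..<n}"
  proof (rule image_subsetI)
    fix u assume "u \<in> {0..<n}"
    then have "{w \<in> {0..<n}. x w < x u} \<subset> {0..<n}" by blast
    then have "r u < card {0..<n}"
      unfolding r_def by (rule psubset_card_mono[rotated]) simp
    then show "r u \<in> {0..<n}" by simp
  qed
  ultimately show "bij_betw r {0..<n} {0..<n}"
    by (simp add: bij_betw_def endo_inj_surj)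
qed

text \<open>Only the relative order of the keys matters, so they may be replaced by ranks; the
  permutation sends the \<open>x\<close>-rank of a vertex to its \<open>y\<close>-rank.\<close>

lemma permutation_graphI:
  fixes x y :: "nat \<Rightarrow> int"
  assumes x: "inj_on x {0..<n}" and y: "inj_on y {0..<n}"
    and E: "\<And>u v. u < n \<Longrightarrow> v < n \<Longrightarrow> E u v \<longleftrightarrow> (x u - x v) * (y u - y v) < 0"
  shows "permutation_graph n E"
proof -
  define f where "f = (\<lambda>u. card {w \<in> {0..<n}. x w < x u})"
  define g where "g = (\<lambda>u. card {w \<in> {0..<n}. y w < y u})"
  have f: "bij_betw f {0..<n} {0..<n}" "\<And>u v. u < n \<Longrightarrow> v < n \<Longrightarrow> f u < f v \<longleftrightarrow> x u < x v"
    using card_less_bij_betw[OF x] unfolding f_def by blast+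
  have g: "bij_betw g {0..<n} {0..<n}" "\<And>u v. u < n \<Longrightarrow> v < n \<Longrightarrow> g u < g v \<longleftrightarrow> y u < y v"
    using card_less_bij_betw[OF y] unfolding g_def by blast+
  define p where "p i = (if i < n then g (inv_into {0..<n} f i) else i)" for i
  have "bij_betw (g \<circ> inv_into {0..<n} f) {0..<n} {0..<n}"
    using bij_betw_trans[OF bij_betw_inv_into[OF f(1)] g(1)] .
  then have "bij_betw p {0..<n} {0..<n}"
    by (rule iffD1[OF bij_betw_cong, rotated]) (auto simp: p_def)
  then have perm: "p permutes {0..<n}"
    by (rule bij_imp_permutes) (auto simp: p_def)
  have pf: "p (f u) = g u" if "u < n" for u
    using that f(1) bij_betwE[OF f(1)] by (auto simp: p_def bij_betw_def)
  have "E u v \<longleftrightarrow> (int (f u) - int (f v)) * (int (p (f u)) - int (p (f v))) < 0"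
    if "u < n" "v < n" for u v
    using that E[OF that] f(2) g(2) by (simp add: pf mult_less_0_iff)
  then show ?thesis
    unfolding permutation_graph_def using f(1) perm by blast
qed

section \<open>The cone over a union of cycles\<close>

text \<open>The vertices \<open>a'\<^sub>i\<close>, \<open>a\<^sub>i\<close>, \<open>b\<^sub>i\<close>, \<open>b'\<^sub>i\<close> are \<open>4 i\<close>, \<open>4 i + 1\<close>, \<open>4 i + 2\<close>, \<open>4 i + 3\<close>,
  and \<open>4 m\<close> is the universal vertex; the vertices above it are pendant and only serve to reach
  every order \<open>n\<close>.\<close>

definition cone_arc :: "nat \<Rightarrow> nat \<Rightarrow> (nat \<Rightarrow> nat) \<Rightarrow> (nat \<Rightarrow> nat) \<Rightarrow> nat \<Rightarrow> nat \<Rightarrow> bool" where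
  "cone_arc m n \<sigma> \<tau> u v \<longleftrightarrow>
     (\<exists>l<m. u = 4 * l \<and> v = 4 * l + 1 \<or> u = 4 * l + 1 \<and> v = 4 * \<sigma> l + 2 \<or>
        u = 4 * l + 2 \<and> v = 4 * l + 3 \<or> u = 4 * \<tau> l + 3 \<and> v = 4 * l) \<or>
     u = 4 * m \<and> v < n \<and> v \<noteq> 4 * m"

definition cone_edge :: "nat \<Rightarrow> nat \<Rightarrow> (nat \<Rightarrow> nat) \<Rightarrow> (nat \<Rightarrow> nat) \<Rightarrow> nat \<Rightarrow> nat \<Rightarrow> bool" where
  "cone_edge m n \<sigma> \<tau> u v \<longleftrightarrow> cone_arc m n \<sigma> \<tau> u v \<or> cone_arc m n \<sigma> \<tau> v u"

lemma permutes_lessThan_less_iff: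
  assumes "\<sigma> permutes {..<m::nat}"
  shows "\<sigma> l < m \<longleftrightarrow> l < m"
  using permutes_in_image[OF assms, of l] by simp

lemma cone_edge_bounds:
  assumes "\<sigma> permutes {..<m}" "\<tau> permutes {..<m}" "4 * m < n" "cone_edge m n \<sigma> \<tau> u v"
  shows "u < n" "v < n"
proof -
  have "\<sigma> l < m" "\<tau> l < m" if "l < m" for l
    using that assms permutes_lessThan_less_iff by blast+
  then have "u < n \<and> v < n" if "cone_arc m n \<sigma> \<tau> u v" for u v
    using that assms(3) unfolding cone_arc_def by fastforce
  then show "u < n" "v < n" using assms(4) unfolding cone_edge_def by blast+
qed

text \<open>The universal vertex \<open>4 * m\<close> connects the graph, and
  \<open>Suc u \<le> n \<le> n ^ k\<close> because \<open>k \<ge> 1\<close>.\<close>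

lemma legal_config_cone:
  assumes "k \<ge> 1" "\<sigma> permutes {..<m}" "\<tau> permutes {..<m}" "4 * m < n"
  shows "legal_config k n (cone_edge m n \<sigma> \<tau>) Suc"
proof -
  let ?E = "cone_edge m n \<sigma> \<tau>"
  have "\<not> ?E u u" for u
    unfolding cone_edge_def cone_arc_def by (auto, presburger+)
  then have "simple_graph n ?E"
    using cone_edge_bounds[OF assms(2-4)] unfolding simple_graph_def
    by (auto simp: cone_edge_def)
  moreover have "?E\<^sup>*\<^sup>* u (4 * m) \<and> ?E\<^sup>*\<^sup>* (4 * m) u" if "u < n" for u
    using that by (cases "u = 4 * m") (auto simp: cone_edge_def cone_arc_def)
  then have "connected_graph n ?E"
    unfolding connected_graph_def by (meson rtranclp_trans)
  moreover have "Suc u \<le> n ^ k" if "u < n" for u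
    using that self_le_power[of n k] assms(1) by linarith
  ultimately show ?thesis
    using assms(4) unfolding legal_config_def by auto
qed

lemma four_mult_add_eq_iff:
  assumes "c < 4" "d < 4"
  shows "4 * p + c = 4 * q + d \<longleftrightarrow> p = q \<and> c = (d :: nat)"
  using assms by presburger

lemmas four_mult_add_eq = four_mult_add_eq_iff[of 0 1, simplified]
  four_mult_add_eq_iff[of 0 2, simplified] four_mult_add_eq_iff[of 0 3, simplified]
  four_mult_add_eq_iff[of 1 0, simplified] four_mult_add_eq_iff[of 1 2, simplified]
  four_mult_add_eq_iff[of 1 3, simplified] four_mult_add_eq_iff[of 2 0, simplified]
  four_mult_add_eq_iff[of 2 1, simplified] four_mult_add_eq_iff[of 2 3, simplified]
  four_mult_add_eq_iff[of 3 0, simplified] four_mult_add_eq_iff[of 3 1, simplified]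
  four_mult_add_eq_iff[of 3 2, simplified]

text \<open>Indexing the last two kinds of vertices through \<open>\<sigma>\<close> and
  \<open>\<tau>\<close> avoids inverse permutations. The second and third neighbourhoods involve
  only \<open>\<sigma>\<close>, the first and fourth only \<open>\<tau>\<close>.\<close>

lemma cone_edge_iff:
  assumes \<sigma>: "\<sigma> permutes {..<m}" and \<tau>: "\<tau> permutes {..<m}" and n: "4 * m < n"
  shows "i < m \<Longrightarrow> cone_edge m n \<sigma> \<tau> (4 * i) v \<longleftrightarrow> v = 4 * i + 1 \<or> v = 4 * \<tau> i + 3 \<or> v = 4 * m"
    and "i < m \<Longrightarrow> cone_edge m n \<sigma> \<tau> (4 * i + 1) v \<longleftrightarrow> v = 4 * i \<or> v = 4 * \<sigma> i + 2 \<or> v = 4 * m"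
    and "i < m \<Longrightarrow> cone_edge m n \<sigma> \<tau> (4 * \<sigma> i + 2) v \<longleftrightarrow>
      v = 4 * i + 1 \<or> v = 4 * \<sigma> i + 3 \<or> v = 4 * m"
    and "i < m \<Longrightarrow> cone_edge m n \<sigma> \<tau> (4 * \<tau> i + 3) v \<longleftrightarrow>
      v = 4 * i \<or> v = 4 * \<tau> i + 2 \<or> v = 4 * m"
    and "cone_edge m n \<sigma> \<tau> (4 * m) v \<longleftrightarrow> v < n \<and> v \<noteq> 4 * m"
    and "u > 4 * m \<Longrightarrow> cone_edge m n \<sigma> \<tau> u v \<longleftrightarrow> u < n \<and> v = 4 * m"
proof -
  have less: "\<sigma> i < m \<longleftrightarrow> i < m" "\<tau> i < m \<longleftrightarrow> i < m" for i
    using permutes_lessThan_less_iff \<sigma> \<tau> by blast+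
  have lt: "\<sigma> i < m" "\<tau> i < m" if "i < m" for i using that less by blast+
  have inj: "\<sigma> i = \<sigma> j \<longleftrightarrow> i = j" "\<tau> i = \<tau> j \<longleftrightarrow> i = j" for i j
    using permutes_inj[OF \<sigma>] permutes_inj[OF \<tau>] by (auto simp: inj_eq)
  show "cone_edge m n \<sigma> \<tau> (4 * i) v \<longleftrightarrow> v = 4 * i + 1 \<or> v = 4 * \<tau> i + 3 \<or> v = 4 * m" if "i < m"
    unfolding cone_edge_def cone_arc_def using that n lt[OF that] by (auto simp: four_mult_add_eq)
  show "cone_edge m n \<sigma> \<tau> (4 * i + 1) v \<longleftrightarrow> v = 4 * i \<or> v = 4 * \<sigma> i + 2 \<or> v = 4 * m" if "i < m"
    unfolding cone_edge_def cone_arc_def using that n lt[OF that] by (auto simp: four_mult_add_eq)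
  show "cone_edge m n \<sigma> \<tau> (4 * \<sigma> i + 2) v \<longleftrightarrow>
      v = 4 * i + 1 \<or> v = 4 * \<sigma> i + 3 \<or> v = 4 * m" if "i < m"
    unfolding cone_edge_def cone_arc_def using that n lt[OF that] by (auto simp: four_mult_add_eq inj)
  show "cone_edge m n \<sigma> \<tau> (4 * \<tau> i + 3) v \<longleftrightarrow>
      v = 4 * i \<or> v = 4 * \<tau> i + 2 \<or> v = 4 * m" if "i < m"
    unfolding cone_edge_def cone_arc_def using that n lt[OF that] by (auto simp: four_mult_add_eq inj)
  show "cone_edge m n \<sigma> \<tau> (4 * m) v \<longleftrightarrow> v < n \<and> v \<noteq> 4 * m"
    unfolding cone_edge_def cone_arc_def using n by (auto simp: four_mult_add_eq less)
  show "cone_edge m n \<sigma> \<tau> u v \<longleftrightarrow> u < n \<and> v = 4 * m" if "u > 4 * m"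
    unfolding cone_edge_def cone_arc_def using n that lt by fastforce
qed

lemma cone_vertex_cases:
  fixes u :: nat
  assumes \<sigma>: "\<sigma> permutes {..<m}"
  obtains i where "i < m" "u = 4 * i" | i where "i < m" "u = 4 * i + 1"
    | i where "i < m" "u = 4 * \<sigma> i + 2" | i where "i < m" "u = 4 * \<sigma> i + 3"
    | "u = 4 * m" | "u > 4 * m"
proof (cases "u < 4 * m")
  case True
  have \<sigma>_inv: "\<sigma> (inv \<sigma> (u div 4)) = u div 4" by (simp add: permutes_inverses[OF \<sigma>])
  have "u div 4 < m" using True by simp
  moreover from this have "inv \<sigma> (u div 4) < m"
    using permutes_lessThan_less_iff[OF permutes_inv[OF \<sigma>]] by simp
  moreover have "u = 4 * (u div 4) \<or> u = 4 * (u div 4) + 1 \<or> u = 4 * (u div 4) + 2 \<or> u = 4 * (u div 4) + 3"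
    by presburger
  ultimately show ?thesis using that \<sigma>_inv by metis
qed (use that in force)

text \<open>A four-cycle \<open>0, 1, 2, 3\<close> is realised by the orders \<open>0 2 1 3\<close> and \<open>1 3 0 2\<close>.\<close>

lemma permutation_graph_cone:
  assumes \<sigma>: "\<sigma> permutes {..<m}" and n: "4 * m < n"
  shows "permutation_graph n (cone_edge m n \<sigma> \<sigma>)"
proof -
  \<comment> \<open>The number of the four-cycle through \<open>u\<close>: cycle \<open>i\<close>
    has the vertices \<open>4 * i\<close>, \<open>4 * i + 1\<close>,
    \<open>4 * \<sigma> i + 2\<close>, \<open>4 * \<sigma> i + 3\<close>.\<close>
  define blk where "blk u = (if u mod 4 < 2 then u div 4 else inv \<sigma> (u div 4))" for u
  \<comment> \<open>Blocks appear in the same order in \<open>x\<close> and \<open>y\<close>, so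
    there is no inversion between two of them. Vertex \<open>4 * m\<close> is first in
    \<open>x\<close> and last in \<open>y\<close>, hence inverted with all others; pendant vertices
    follow all blocks in both orders, hence are inverted with \<open>4 * m\<close> only.\<close>
  define x :: "nat \<Rightarrow> int" where "x u = (if u < 4 * m then 4 * int (blk u) +
      (if u mod 4 = 0 then 0 else if u mod 4 = 1 then 2 else if u mod 4 = 2 then 1 else 3)
    else if u = 4 * m then -1 else int u)" for u
  define y :: "nat \<Rightarrow> int" where "y u = (if u < 4 * m then 4 * int (blk u) +
      (if u mod 4 = 0 then 2 else if u mod 4 = 1 then 0 else if u mod 4 = 2 then 3 else 1)
    else if u = 4 * m then int n else int u)" for u
  have inv_less: "inv \<sigma> l < m \<longleftrightarrow> l < m" for l
    using permutes_lessThan_less_iff[OF permutes_inv[OF \<sigma>]] .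
  have inv_eq: "inv \<sigma> i = j \<longleftrightarrow> i = \<sigma> j" for i j
    using permutes_inverses[OF \<sigma>] by metis
  have blk_less: "blk u < m" if "u < 4 * m" for u
    using that inv_less by (auto simp: blk_def)
  have blk_inj: "u = v" if "blk u = blk v" "u mod 4 = v mod 4" for u v
  proof -
    have "u div 4 = v div 4"
      using that inv_eq by (metis blk_def)
    then show ?thesis using that(2) by (metis div_mult_mod_eq)
  qed
  have mod4: "u mod 4 = 0 \<or> u mod 4 = 1 \<or> u mod 4 = 2 \<or> u mod 4 = 3" for u :: nat by presburger
  \<comment> \<open>A four-cycle is complete bipartite between its even and its odd
    positions.\<close>
  have edge: "cone_edge m n \<sigma> \<sigma> u v \<longleftrightarrow> blk u = blk v \<and> odd (u mod 4 + v mod 4)"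
    if "u < 4 * m" "v < 4 * m" for u v
  proof -
    have vert: "v = 4 * i \<longleftrightarrow> blk v = i \<and> v mod 4 = 0" "v = 4 * i + 1 \<longleftrightarrow> blk v = i \<and> v mod 4 = 1"
      "v = 4 * \<sigma> i + 2 \<longleftrightarrow> blk v = i \<and> v mod 4 = 2" "v = 4 * \<sigma> i + 3 \<longleftrightarrow> blk v = i \<and> v mod 4 = 3" for v i
    proof -
      have mods: "(4 * p) mod 4 = 0" "(4 * p + 1) mod 4 = 1" "(4 * p + 2) mod 4 = 2" "(4 * p + 3) mod 4 = 3"
        for p :: nat by presburger+
      moreover have "(4 * p) div 4 = p" "(4 * p + 1) div 4 = p" "(4 * p + 2) div 4 = p" "(4 * p + 3) div 4 = p"
        for p :: nat by presburger+
      ultimately have "blk (4 * i) = i" "blk (4 * i + 1) = i" "blk (4 * \<sigma> i + 2) = i" "blk (4 * \<sigma> i + 3) = i"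
        unfolding blk_def by (simp_all only: permutes_inverses[OF \<sigma>]) auto
      with mods show "v = 4 * i \<longleftrightarrow> blk v = i \<and> v mod 4 = 0" "v = 4 * i + 1 \<longleftrightarrow> blk v = i \<and> v mod 4 = 1"
        "v = 4 * \<sigma> i + 2 \<longleftrightarrow> blk v = i \<and> v mod 4 = 2" "v = 4 * \<sigma> i + 3 \<longleftrightarrow> blk v = i \<and> v mod 4 = 3"
        using blk_inj by metis+
    qed
    note nbrs = cone_edge_iff[OF \<sigma> \<sigma> n, where v = v]
    have v: "v \<noteq> 4 * m" using that by simp
    from \<sigma> show ?thesis
    proof (cases rule: cone_vertex_cases[of \<sigma> m u])
      case (1 i)
      then have "cone_edge m n \<sigma> \<sigma> u v \<longleftrightarrow> v = 4 * i + 1 \<or> v = 4 * \<sigma> i + 3" using nbrs(1) v by blast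
      then show ?thesis
        using vert(1)[of u i] vert(2)[of v i] vert(4)[of v i] 1(2) mod4[of v] by auto
    next
      case (2 i)
      then have "cone_edge m n \<sigma> \<sigma> u v \<longleftrightarrow> v = 4 * i \<or> v = 4 * \<sigma> i + 2" using nbrs(2) v by blast
      then show ?thesis
        using vert(2)[of u i] vert(1)[of v i] vert(3)[of v i] 2(2) mod4[of v] by auto
    next
      case (3 i)
      then have "cone_edge m n \<sigma> \<sigma> u v \<longleftrightarrow> v = 4 * i + 1 \<or> v = 4 * \<sigma> i + 3" using nbrs(3) v by blast
      then show ?thesis
        using vert(3)[of u i] vert(2)[of v i] vert(4)[of v i] 3(2) mod4[of v] by auto
    next
      case (4 i)
      then have "cone_edge m n \<sigma> \<sigma> u v \<longleftrightarrow> v = 4 * i \<or> v = 4 * \<sigma> i + 2" using nbrs(4) v by blast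
      then show ?thesis
        using vert(4)[of u i] vert(1)[of v i] vert(3)[of v i] 4(2) mod4[of v] by auto
    qed (use that in auto)
  qed
  have low: "0 \<le> x u \<and> x u < 4 * int m \<and> 0 \<le> y u \<and> y u < 4 * int m" if "u < 4 * m" for u
    using that blk_less[OF that] by (auto simp: x_def y_def)
  have apex: "x (4 * m) = -1" "y (4 * m) = int n"
    by (auto simp: x_def y_def)
  have high: "x u = int u \<and> y u = int u" if "u > 4 * m" for u
    using that by (auto simp: x_def y_def)
  have inj: "u = v" if "u < n" "v < n" "x u = x v \<or> y u = y v" for u v
  proof (cases "u < 4 * m \<and> v < 4 * m")
    case True
    then have "blk u = blk v \<and> u mod 4 = v mod 4"
      using that(3) mod4[of u] mod4[of v] unfolding x_def y_def
      by (elim disjE; simp; presburger)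
    then show ?thesis using blk_inj by blast
  next
    case False
    then show ?thesis
      using that low[of u] low[of v] apex high[of u] high[of v]
      by (cases u "4 * m" rule: linorder_cases; cases v "4 * m" rule: linorder_cases; auto)
  qed
  show ?thesis
  proof (rule permutation_graphI[of x n y])
    show "inj_on x {0..<n}" "inj_on y {0..<n}"
      using inj by (auto intro!: inj_onI)
    fix u v assume uv: "u < n" "v < n"
    have sym: "cone_edge m n \<sigma> \<sigma> u v \<longleftrightarrow> cone_edge m n \<sigma> \<sigma> v u"
      by (auto simp: cone_edge_def)
    consider "u < 4 * m" "v < 4 * m" | "u = 4 * m" | "v = 4 * m" | "u > 4 * m" "v \<noteq> 4 * m"
      | "v > 4 * m" "u \<noteq> 4 * m" by linarith
    then show "cone_edge m n \<sigma> \<sigma> u v \<longleftrightarrow> (x u - x v) * (y u - y v) < 0"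
    proof cases
      case 1
      then show ?thesis
        using mod4[of u] mod4[of v]
        by (elim disjE) (auto simp: edge x_def y_def mult_less_0_iff)
    next
      case 2
      then show ?thesis
        using uv low[of v] high[of v] apex cone_edge_iff(5)[OF \<sigma> \<sigma> n]
        by (cases v "4 * m" rule: linorder_cases) (auto simp: mult_less_0_iff)
    next
      case 3
      then show ?thesis
        using uv low[of u] high[of u] apex cone_edge_iff(5)[OF \<sigma> \<sigma> n] sym
        by (cases u "4 * m" rule: linorder_cases) (auto simp: mult_less_0_iff)
    next
      case 4
      then show ?thesis
        using uv low[of v] high cone_edge_iff(6)[OF \<sigma> \<sigma> n]
        by (cases v "4 * m" rule: linorder_cases) (auto simp: mult_less_0_iff)
    next
      case 5
      then show ?thesis
        using uv low[of u] high cone_edge_iff(6)[OF \<sigma> \<sigma> n] sym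
        by (cases u "4 * m" rule: linorder_cases) (auto simp: mult_less_0_iff)
    qed
  qed
qed

text \<open>This lets local views of two yes-instances be spliced. The universal and pendant
  vertices see neither permutation and are assigned to the \<open>\<sigma>\<close> side.\<close>

lemma cone_edge_cong:
  assumes \<sigma>: "\<sigma> permutes {..<m}" and \<tau>: "\<tau> permutes {..<m}" and n: "4 * m < n"
  shows "u \<ge> 4 * m \<or> u mod 4 \<in> {1, 2} \<Longrightarrow> cone_edge m n \<sigma> \<tau> u v \<longleftrightarrow> cone_edge m n \<sigma> \<sigma> u v"
    and "\<not> (u \<ge> 4 * m \<or> u mod 4 \<in> {1, 2}) \<Longrightarrow> cone_edge m n \<sigma> \<tau> u v \<longleftrightarrow> cone_edge m n \<tau> \<tau> u v"
proof -
  assume u: "u \<ge> 4 * m \<or> u mod 4 \<in> {1, 2}"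
  from \<sigma> show "cone_edge m n \<sigma> \<tau> u v \<longleftrightarrow> cone_edge m n \<sigma> \<sigma> u v"
  proof (cases rule: cone_vertex_cases[of \<sigma> m u])
    case (1 i)
    then show ?thesis using u by auto
  next
    case (2 i)
    then show ?thesis by (simp only: cone_edge_iff[OF \<sigma> \<tau> n] cone_edge_iff[OF \<sigma> \<sigma> n])
  next
    case (3 i)
    then show ?thesis by (simp only: cone_edge_iff[OF \<sigma> \<tau> n] cone_edge_iff[OF \<sigma> \<sigma> n])
  next
    case (4 i)
    moreover from this have "\<sigma> i < m" using permutes_lessThan_less_iff[OF \<sigma>] by blast
    moreover have "u mod 4 = 3" using 4(2) by presburger
    ultimately show ?thesis using u by auto
  next
    case 5
    then show ?thesis by (simp only: cone_edge_iff(5)[OF \<sigma> \<tau> n] cone_edge_iff(5)[OF \<sigma> \<sigma> n])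
  next
    case 6
    then show ?thesis by (simp only: cone_edge_iff(6)[OF \<sigma> \<tau> n] cone_edge_iff(6)[OF \<sigma> \<sigma> n])
  qed
next
  assume u: "\<not> (u \<ge> 4 * m \<or> u mod 4 \<in> {1, 2})"
  \<comment> \<open>The case split now runs along \<open>\<tau>\<close>, which indexes the vertices
    with residue 3 in both graphs.\<close>
  from \<tau> show "cone_edge m n \<sigma> \<tau> u v \<longleftrightarrow> cone_edge m n \<tau> \<tau> u v"
  proof (cases rule: cone_vertex_cases[of \<tau> m u])
    case (1 i)
    then show ?thesis by (simp only: cone_edge_iff[OF \<sigma> \<tau> n] cone_edge_iff[OF \<tau> \<tau> n])
  next
    case (2 i)
    then have "u mod 4 = 1" by presburger
    then show ?thesis using u by simp
  next
    case (3 i)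
    then have "u mod 4 = 2" by presburger
    then show ?thesis using u by simp
  next
    case (4 i)
    then show ?thesis by (simp only: cone_edge_iff[OF \<sigma> \<tau> n] cone_edge_iff[OF \<tau> \<tau> n])
  qed (use u in auto)
qed

section \<open>Mixed instances and asteroidal triples\<close>

text \<open>\<open>Q\<close> travels from \<open>\<rho> l\<close> along the orbit, which returns to
  \<open>l\<close>. If \<open>Q l\<close> failed, \<open>\<rho>\<close> would permute the set
  \<open>T\<close> where \<open>Q\<close> holds, so \<open>\<rho> l\<close> would have a preimage in
  \<open>T\<close>, and by injectivity that is \<open>l\<close>.\<close>

lemma finite_orbit_closed:
  fixes \<rho> :: "'a \<Rightarrow> 'a"
  assumes "finite S" "inj_on \<rho> S" "l \<in> S" "\<rho> ` S \<subseteq> S"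
    and step: "\<And>i. i \<in> S \<Longrightarrow> i \<noteq> l \<Longrightarrow> Q i \<Longrightarrow> Q (\<rho> i)" and "Q (\<rho> l)"
  shows "Q l"
proof (rule ccontr)
  assume "\<not> Q l"
  define T where "T = {i \<in> S. Q i}"
  have "\<rho> ` T \<subseteq> T"
    using step \<open>\<not> Q l\<close> assms(4) by (auto simp: T_def)
  moreover have "finite T" "inj_on \<rho> T"
    using assms(1,2) by (auto simp: T_def inj_on_def)
  ultimately have "\<rho> ` T = T" by (intro endo_inj_surj)
  moreover have "\<rho> l \<in> T" using assms(3,4,6) by (auto simp: T_def)
  ultimately obtain i where "i \<in> T" "\<rho> i = \<rho> l" by (metis imageE)
  then show False
    using assms(2,3) \<open>\<not> Q l\<close> by (auto simp: T_def inj_on_def)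
qed

text \<open>The vertices \<open>x\<close>, \<open>y\<close>, \<open>w\<close> below form an asteroidal triple: any two of
  them are joined by a path avoiding the closed neighbourhood of the third, so the third lies on
  the same side of both. For \<open>y\<close> and \<open>w\<close> this path is the long way around the cycle.\<close>

lemma not_trapezoid_graph_cone:
  assumes \<sigma>: "\<sigma> permutes {..<m}" and \<tau>: "\<tau> permutes {..<m}"
    and "\<sigma> \<noteq> \<tau>" and n: "4 * m < n"
  shows "\<not> trapezoid_graph n (cone_edge m n \<sigma> \<tau>)"
proof
  let ?E = "cone_edge m n \<sigma> \<tau>"
  assume "trapezoid_graph n ?E"
  from trapezoid_graph_cocomparability[OF this] obtain L where L: "irreflp L" "transp L"
    and "\<forall>u<n. \<forall>v<n. u \<noteq> v \<longrightarrow> (?E u v \<longleftrightarrow> \<not> L u v \<and> \<not> L v u)"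
    by (elim exE conjE)
  note E = this(3)[rule_format]
  from L have irrefl: "\<not> L u u" and trans: "L u v \<Longrightarrow> L v w \<Longrightarrow> L u w" for u v w
    by (auto simp: irreflp_def dest: transpD)
  \<comment> \<open>Four steps along a cycle lead from \<open>4 * i\<close> to
    \<open>4 * \<rho> i\<close>, so fixed points of \<open>\<rho>\<close> are four-cycles and other
    orbits are longer cycles.\<close>
  define \<rho> where "\<rho> = inv \<tau> \<circ> \<sigma>"
  have \<rho>: "\<rho> permutes {..<m}"
    unfolding \<rho>_def by (intro permutes_compose \<sigma> permutes_inv \<tau>)
  have \<tau>\<rho>: "\<tau> (\<rho> i) = \<sigma> i" for i
    unfolding \<rho>_def by (simp add: permutes_inverses[OF \<tau>])
  have less: "\<sigma> i < m" "\<tau> i < m" "\<rho> i < m" if "i < m" for i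
    using that permutes_lessThan_less_iff \<sigma> \<tau> \<rho> by blast+
  have inj: "\<sigma> i = \<sigma> j \<longleftrightarrow> i = j" "\<tau> i = \<tau> j \<longleftrightarrow> i = j" for i j
    using permutes_inj[OF \<sigma>] permutes_inj[OF \<tau>] by (auto simp: inj_eq)
  obtain l where l: "\<sigma> l \<noteq> \<tau> l" using \<open>\<sigma> \<noteq> \<tau>\<close> by blast
  then have lm: "l < m" using \<sigma> \<tau> by (metis lessThan_iff permutes_not_in)
  have \<rho>l: "\<rho> l \<noteq> l" using l \<tau>\<rho> by metis
  have edges: "?E (4 * i) (4 * i + 1)" "?E (4 * i + 1) (4 * \<sigma> i + 2)"
    "?E (4 * \<sigma> i + 2) (4 * \<sigma> i + 3)" "?E (4 * \<sigma> i + 3) (4 * \<rho> i)" if "i < m" for i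
    using cone_edge_iff(1-3)[OF \<sigma> \<tau> n that] cone_edge_iff(4)[OF \<sigma> \<tau> n less(3)[OF that]]
    unfolding \<tau>\<rho> by blast+
  \<comment> \<open>If \<open>p\<close> lay between \<open>q\<close> and \<open>q'\<close>,
    transitivity would make these adjacent vertices comparable.\<close>
  have side: "L p q \<longleftrightarrow> L p q'"
    if "?E q q'" "\<not> ?E p q" "\<not> ?E p q'" "p \<noteq> q" "p \<noteq> q'" "p < n" for p q q'
  proof -
    have "q < n" "q' < n" using cone_edge_bounds[OF \<sigma> \<tau> n that(1)] .
    moreover have "q \<noteq> q'"
      using that(1) legal_config_cone[OF order_refl \<sigma> \<tau> n]
      by (auto simp: legal_config_def simple_graph_def)
    ultimately show ?thesis using that E[of q q'] E[of p q] E[of p q'] trans by blast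
  qed
  note nbr0 = cone_edge_iff(1)[OF \<sigma> \<tau> n] and nbr2 = cone_edge_iff(3)[OF \<sigma> \<tau> n]
  \<comment> \<open>On the cycle, \<open>y\<close> comes two steps before \<open>x\<close> and
    \<open>w\<close> two steps after it.\<close>
  define x where "x = 4 * \<sigma> l + 2"
  define y where "y = 4 * l"
  define w where "w = 4 * \<rho> l"
  have lt: "x < n" "y < n" "w < n"
    using less[OF lm] lm n by (auto simp: x_def y_def w_def)
  have ne: "x \<noteq> y" "x \<noteq> w" "y \<noteq> w"
    using \<rho>l by (auto simp: x_def y_def w_def) presburger+
  have nE: "\<not> ?E x y" "\<not> ?E x w" "\<not> ?E y w"
    using lm less(3)[OF lm] nbr0[OF lm] nbr2[OF lm]
    by (auto simp: x_def y_def w_def four_mult_add_eq)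
  \<comment> \<open>The path from \<open>x\<close> to \<open>w\<close> runs through
    \<open>4 * \<sigma> l + 3\<close>, while \<open>y\<close> is adjacent to
    \<open>4 * \<tau> l + 3\<close>.\<close>
  have A: "L y x \<longleftrightarrow> L y w"
  proof -
    have "\<not> ?E y (4 * \<sigma> l + 3)" "y \<noteq> 4 * \<sigma> l + 3"
      using lm less(1)[OF lm] l nbr0[OF lm] by (auto simp: y_def four_mult_add_eq)
    moreover have "\<not> ?E y x" using nE(1) by (auto simp: cone_edge_def)
    ultimately have "L y x \<longleftrightarrow> L y (4 * \<sigma> l + 3)" "L y (4 * \<sigma> l + 3) \<longleftrightarrow> L y w"
      using side[OF edges(3)[OF lm], of y] side[OF edges(4)[OF lm], of y] nE(3) lt(2) ne
      unfolding x_def w_def by blast+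
    then show ?thesis by blast
  qed
  have B: "L w y \<longleftrightarrow> L w x"
  proof -
    have "\<not> ?E w (4 * l + 1)" "w \<noteq> 4 * l + 1"
      using lm \<rho>l nbr0[OF less(3)[OF lm]] by (auto simp: w_def four_mult_add_eq)
    moreover have "\<not> ?E w x" "\<not> ?E w y" using nE by (auto simp: cone_edge_def)
    ultimately have "L w y \<longleftrightarrow> L w (4 * l + 1)" "L w (4 * l + 1) \<longleftrightarrow> L w x"
      using side[OF edges(1)[OF lm], of w] side[OF edges(2)[OF lm], of w] lt(3) ne
      unfolding x_def y_def by blast+
    then show ?thesis by blast
  qed
  \<comment> \<open>One portion of the long way around; it stays off the neighbours
    \<open>4 * l + 1\<close> and \<open>4 * \<sigma> l + 3\<close> of \<open>x\<close> because
    \<open>i \<noteq> l\<close>.\<close>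
  have step: "L x (4 * i) \<longleftrightarrow> L x (4 * \<rho> i)" if i: "i < m" "i \<noteq> l" for i
  proof -
    have far: "\<not> ?E x v \<and> x \<noteq> v"
      if "v \<in> {4 * i, 4 * i + 1, 4 * \<sigma> i + 2, 4 * \<sigma> i + 3, 4 * \<rho> i}" for v
      using that i less[OF i(1)] nbr2[OF lm, of v]
      by (auto simp: x_def four_mult_add_eq inj)
    have "L x (4 * i) \<longleftrightarrow> L x (4 * i + 1)"
      using side[OF edges(1)[OF i(1)], of x] far lt(1) by blast
    also have "\<dots> \<longleftrightarrow> L x (4 * \<sigma> i + 2)"
      using side[OF edges(2)[OF i(1)], of x] far lt(1) by blast
    also have "\<dots> \<longleftrightarrow> L x (4 * \<sigma> i + 3)"
      using side[OF edges(3)[OF i(1)], of x] far lt(1) by blast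
    also have "\<dots> \<longleftrightarrow> L x (4 * \<rho> i)"
      using side[OF edges(4)[OF i(1)], of x] far lt(1) by blast
    finally show ?thesis .
  qed
  have orbit: "Q l" if "\<And>i. i < m \<Longrightarrow> i \<noteq> l \<Longrightarrow> Q i \<Longrightarrow> Q (\<rho> i)" "Q (\<rho> l)" for Q
    using that lm less(3) permutes_inj_on[OF \<rho>]
    by (intro finite_orbit_closed[of "{..<m}" \<rho> l Q]) auto
  \<comment> \<open>\<open>orbit\<close> carries truth only from \<open>\<rho> l\<close> to
    \<open>l\<close>; applying it to the negation as well gives the converse.\<close>
  have C: "L x y \<longleftrightarrow> L x w"
    using orbit[of "\<lambda>i. L x (4 * i)"] orbit[of "\<lambda>i. \<not> L x (4 * i)"] step
    unfolding y_def w_def by blast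
  show False
  proof -
    \<comment> \<open>Three pairwise comparable vertices have a middle one, whereas
      \<open>A\<close>, \<open>B\<close> and \<open>C\<close> say that none of them is in the
      middle.\<close>
    have "L x y \<noteq> L y x" "L x w \<noteq> L w x" "L y w \<noteq> L w y"
      using E[of x y] E[of x w] E[of y w] lt ne nE irrefl trans by blast+
    then show False using A B C by blast
  qed
qed

section \<open>Counting certificates\<close>

lemma card_bounded_bool_lists:
  "finite {c :: bool list. length c \<le> s}" "card {c :: bool list. length c \<le> s} \<le> 2 ^ (s + 1)"
proof -
  have eq: "{c :: bool list. length c \<le> s} = {c. set c \<subseteq> UNIV \<and> length c \<le> s}" by simp
  show "finite {c :: bool list. length c \<le> s}"
    unfolding eq by (rule finite_lists_length_le) simp
  have "card {c :: bool list. length c \<le> s} = (\<Sum>i\<le>s. 2 ^ i)"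
    unfolding eq by (subst card_lists_length_le) auto
  also have "\<dots> \<le> 2 ^ (s + 1)"
    by (induction s) auto
  finally show "card {c :: bool list. length c \<le> s} \<le> 2 ^ (s + 1)" .
qed

text \<open>\<open>P\<close> is any class between permutation graphs and trapezoid graphs, which
  covers both halves of the theorem.\<close>

lemma pls_fact_le:
  assumes pls: "is_pls P k Ver s" and "k \<ge> 1"
    and yes: "\<And>E. permutation_graph n E \<Longrightarrow> P n E"
    and no: "\<And>E. P n E \<Longrightarrow> trapezoid_graph n E"
    and n: "4 * m < n"
  shows "(fact m :: nat) \<le> (2 ^ (s n + 1)) ^ n"
proof (rule ccontr)
  assume large: "\<not> (fact m :: nat) \<le> (2 ^ (s n + 1)) ^ n"
  let ?E = "cone_edge m n"
  let ?S = "{\<sigma>. \<sigma> permutes {..<m}}"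
  let ?C = "{c :: bool list. length c \<le> s n}"
  have "\<exists>cert. (\<forall>u<n. length (cert u) \<le> s n) \<and> (\<forall>u<n. Ver (local_view n (?E \<sigma> \<sigma>) Suc cert u))"
    if "\<sigma> \<in> ?S" for \<sigma>
    using pls legal_config_cone[of k \<sigma> m \<sigma> n] permutation_graph_cone[of \<sigma> m n] that yes n \<open>k \<ge> 1\<close>
    unfolding is_pls_def by blast
  then obtain cert where
    len: "\<And>\<sigma> u. \<sigma> \<in> ?S \<Longrightarrow> u < n \<Longrightarrow> length (cert \<sigma> u) \<le> s n" and
    acc: "\<And>\<sigma> u. \<sigma> \<in> ?S \<Longrightarrow> u < n \<Longrightarrow> Ver (local_view n (?E \<sigma> \<sigma>) Suc (cert \<sigma>) u)"
    by metis
  \<comment> \<open>Values of a certificate function beyond \<open>n\<close> are arbitrary;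
    restriction leaves finitely many assignments to count.\<close>
  let ?r = "\<lambda>\<sigma>. restrict (cert \<sigma>) {..<n}"
  have "?r ` ?S \<subseteq> {..<n} \<rightarrow>\<^sub>E ?C" using len by (auto intro!: restrict_PiE_iff[THEN iffD2])
  then have "card (?r ` ?S) \<le> card ({..<n} \<rightarrow>\<^sub>E ?C)"
    by (intro card_mono finite_PiE card_bounded_bool_lists) auto
  also have "\<dots> = card ?C ^ n" by (simp add: card_PiE)
  also have "\<dots> \<le> (2 ^ (s n + 1)) ^ n"
    by (intro power_mono card_bounded_bool_lists) auto
  also have "\<dots> < card ?S"
    using large card_permutations[of "{..<m}" m] by simp
  finally have "\<not> inj_on ?r ?S" by (rule pigeonhole)
  then obtain \<sigma> \<tau> where \<sigma>: "\<sigma> \<in> ?S" and \<tau>: "\<tau> \<in> ?S" and ne: "\<sigma> \<noteq> \<tau>" and eq: "?r \<sigma> = ?r \<tau>"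
    unfolding inj_on_def by blast
  have same: "cert \<sigma> u = cert \<tau> u" if "u < n" for u
    using fun_cong[OF eq, of u] that by simp
  have "Ver (local_view n (?E \<sigma> \<tau>) Suc (cert \<sigma>) u)" if "u < n" for u
  proof (cases "u \<ge> 4 * m \<or> u mod 4 \<in> {1, 2}")
    case True
    then have "local_view n (?E \<sigma> \<tau>) Suc (cert \<sigma>) u = local_view n (?E \<sigma> \<sigma>) Suc (cert \<sigma>) u"
      unfolding local_view_def using cone_edge_cong(1)[of \<sigma> m \<tau> n u] \<sigma> \<tau> n by simp
    then show ?thesis using acc[OF \<sigma> that] by simp
  next
    case False
    then have "?E \<sigma> \<tau> u v \<longleftrightarrow> ?E \<tau> \<tau> u v" for v
      using cone_edge_cong(2)[of \<sigma> m \<tau> n u v] \<sigma> \<tau> n by simp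
    then have "{(Suc v, cert \<sigma> v) |v. v < n \<and> ?E \<sigma> \<tau> u v} = {(Suc v, cert \<tau> v) |v. v < n \<and> ?E \<tau> \<tau> u v}"
      using same by force
    then have "local_view n (?E \<sigma> \<tau>) Suc (cert \<sigma>) u = local_view n (?E \<tau> \<tau>) Suc (cert \<tau>) u"
      unfolding local_view_def using same[OF that] by simp
    then show ?thesis using acc[OF \<tau> that] by simp
  qed
  then have "P n (?E \<sigma> \<tau>)"
    using pls legal_config_cone[of k \<sigma> m \<tau> n] \<sigma> \<tau> n \<open>k \<ge> 1\<close> unfolding is_pls_def by blast
  then show False
    using no not_trapezoid_graph_cone[of \<sigma> m \<tau> n] \<sigma> \<tau> ne n by blast
qed

section \<open>From the factorial bound to the logarithmic bound\<close>

text \<open>\<open>m ^ m / fact m\<close> is a single term of the exponential series at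
  \<open>m\<close>, hence at most \<open>exp m\<close>.\<close>

lemma ln_fact_ge:
  assumes "m > 0"
  shows "real m * ln (real m) - real m \<le> ln (fact m)"
proof -
  have sums: "(\<lambda>i. real m ^ i /\<^sub>R fact i) sums exp (real m)"
    by (rule exp_converges)
  have "(\<Sum>i\<in>{m}. real m ^ i /\<^sub>R fact i) \<le> (\<Sum>i. real m ^ i /\<^sub>R fact i)"
    using sums by (intro sum_le_suminf) (auto simp: sums_iff)
  then have "real m ^ m / fact m \<le> exp (real m)"
    using sums by (simp add: sums_iff field_simps)
  then have "ln (real m ^ m / fact m) \<le> ln (exp (real m))"
    using assms by (intro ln_mono) auto
  then show ?thesis using assms by (simp add: ln_div ln_realpow)
qed

lemma bigomega_ln_if_fact_le:
  fixes s :: "nat \<Rightarrow> nat"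
  assumes "\<And>m n. 4 * m < n \<Longrightarrow> (fact m :: nat) \<le> (2 ^ (s n + 1)) ^ n"
  shows "(\<lambda>n. real (s n)) \<in> \<Omega>(\<lambda>n. ln (real n))"
\<comment> \<open>The estimate below is \<open>s n + 1 \<ge> (ln n - 8) / 8\<close>, that is
  \<open>s n \<ge> ln n / 8 - 2\<close>, which is at least \<open>ln n / 16\<close> once
  \<open>ln n \<ge> 32\<close>; the threshold 40 is ample.\<close>
proof (rule landau_omega.bigI[of "1 / 16"])
  have "filterlim (\<lambda>n. ln (real n)) at_top sequentially"
    by (intro filterlim_compose[OF ln_at_top] filterlim_real_sequentially)
  then have "\<forall>\<^sub>F n in sequentially. ln (real n) \<ge> 40"
    by (simp add: filterlim_at_top)
  then show "\<forall>\<^sub>F n in sequentially. norm (real (s n)) \<ge> 1 / 16 * norm (ln (real n))"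
    using eventually_ge_at_top[of 8]
  proof eventually_elim
    case (elim n)
    \<comment> \<open>The largest \<open>m\<close> with \<open>4 * m < n\<close>; from
      \<open>n \<ge> 8\<close> on it is at least \<open>n / 8\<close>.\<close>
    define m where "m = (n - 1) div 4"
    have m: "4 * m < n" "n \<le> 8 * m" "0 < m"
      using elim(2) unfolding m_def by presburger+
    have "real (fact m) \<le> real ((2 ^ (s n + 1)) ^ n)"
      using assms[OF m(1)] by (rule of_nat_mono)
    then have "ln (fact m) \<le> ln (((2 :: real) ^ (s n + 1)) ^ n)"
      by (intro ln_mono) auto
    also have "\<dots> = real n * (real (s n + 1) * ln 2)"
      by (simp only: ln_realpow zero_less_power zero_less_numeral)
    also have "\<dots> \<le> real n * (real (s n + 1) * 1)"
      using ln_2_less_1 by (intro mult_left_mono) auto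
    finally have up: "ln (fact m) \<le> n * (s n + 1)" by (simp add: algebra_simps)
    have "ln (real n / 8) \<le> ln (real m)"
      using m elim(2) by (intro ln_mono) auto
    moreover have "ln 8 \<le> (7 :: real)"
      using ln_le_minus_one[of 8] by simp
    ultimately have ln_m: "ln (real n) - 8 \<le> ln (real m) - 1"
      using elim(2) by (simp add: ln_div)
    have "(n / 8) * (ln (real n) - 8) \<le> m * (ln (real m) - 1)"
      using m elim(1) ln_m by (intro mult_mono) auto
    also have "\<dots> \<le> n * (s n + 1)"
      using ln_fact_ge[OF m(3)] up by (simp add: algebra_simps)
    finally have "real n * ((ln (real n) - 8) / 8) \<le> real n * real (s n + 1)"
      by (simp add: algebra_simps)
    then have "(ln (real n) - 8) / 8 \<le> real (s n + 1)"
      by (rule mult_left_le_imp_le) (use elim(2) in simp)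
    then show ?case using elim(1) by simp
  qed
qed simp

theorem theorem5:
  fixes k :: nat
  assumes "k \<ge> 1"
  shows "(\<forall>Ver s. is_pls permutation_graph k Ver s \<longrightarrow>
            (\<lambda>n. real (s n)) \<in> \<Omega>(\<lambda>n. ln (real n))) \<and>
         (\<forall>Ver s. is_pls trapezoid_graph k Ver s \<longrightarrow>
            (\<lambda>n. real (s n)) \<in> \<Omega>(\<lambda>n. ln (real n)))"
proof (intro conjI allI impI)
  fix Ver s
  show "(\<lambda>n. real (s n)) \<in> \<Omega>(\<lambda>n. ln (real n))" if "is_pls permutation_graph k Ver s"
    using pls_fact_le[OF that assms] permutation_graph_imp_trapezoid_graph
    by (intro bigomega_ln_if_fact_le) blast
  show "(\<lambda>n. real (s n)) \<in> \<Omega>(\<lambda>n. ln (real n))" if "is_pls trapezoid_graph k Ver s"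
    using pls_fact_le[OF that assms] permutation_graph_imp_trapezoid_graph
    by (intro bigomega_ln_if_fact_le) blast
qed

end
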